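(* Every finitely generated group is weakly amenable.
   Context: A countable group $G$ is weakly amenable if either $G$ is finite, or there is an equivalence relation $\sim$ on $G$ such that (1) $G/\!\sim$ is infinite, (2) for every $g\in G$ there is $b(g)\in\mathbb{N}$ such that for every class $C\in G/\!\sim$, $|\{C'\in G/\!\sim: gC\cap C'\neq\emptyset\}|\le b(g)$; and there is an increasing sequence of finite sets $A_n\subseteq G/\!\sim$ with $\bigcup_n A_n=G/\!\sim$ such that for every $g\in G$, $\lim_{n\to\infty}|\{C\in A_n: gC\subseteq \bigcup A_n\}|/|A_n|=1$, where $\bigcup A_n$ is the union of the classes in $A_n$. *)

theory Defs
  imports "HOL-Algebra.Generated_Groups" "HOL-Algebra.Coset" "HOL-Library.Countable_Set" Complex_Main
begin

definition finitely_generated_group :: "('a, 'b) monoid_scheme \<Rightarrow> bool" where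
  "finitely_generated_group G \<longleftrightarrow>
     group G \<and> (\<exists>S. finite S \<and> S \<subseteq> carrier G \<and> generate G S = carrier G)"

text \<open>The finiteness conjunct in the second condition is needed because \<^const>\<open>card\<close> of an
  infinite set is 0. The sets \<open>A n\<close> are sets of classes, so \<open>\<Union>n. A n\<close> is a set of classes,
  whereas \<open>\<Union>(A n)\<close> is a subset of the group.\<close>

definition weakly_amenable :: "('a, 'b) monoid_scheme \<Rightarrow> bool" where
  "weakly_amenable G \<longleftrightarrow>
     group G \<and> countable (carrier G) \<and>
     (finite (carrier G) \<or>
      (\<exists>r. equiv (carrier G) r \<and>
           infinite (carrier G // r) \<and>
           (\<forall>g\<in>carrier G. \<exists>b::nat. \<forall>C\<in>carrier G // r.
              finite {C' \<in> carrier G // r. (g <#\<^bsub>G\<^esub> C) \<inter> C' \<noteq> {}} \<and>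
              card {C' \<in> carrier G // r. (g <#\<^bsub>G\<^esub> C) \<inter> C' \<noteq> {}} \<le> b) \<and>
           (\<exists>A :: nat \<Rightarrow> 'a set set.
              incseq A \<and> (\<forall>n. finite (A n)) \<and> (\<Union>n. A n) = carrier G // r \<and>
              (\<forall>g\<in>carrier G.
                 (\<lambda>n. real (card {C \<in> A n. g <#\<^bsub>G\<^esub> C \<subseteq> \<Union>(A n)}) / real (card (A n)))
                   \<longlonglongrightarrow> 1))))"

end

theory Submission
  imports Defs
begin

text \<open>Partition an infinite finitely generated group into the spheres of a word length. Translation
  by \<open>g\<close> moves the radius of an element by an amount bounded in terms of \<open>g\<close> only, so it acts on the
  space of spheres, a copy of \<open>\<nat>\<close>, with bounded displacement. The initial segments of \<open>\<nat>\<close> are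
  therefore Folner sets, whatever the growth of the group.\<close>

section \<open>Spheres of a length function as classes\<close>

definition length_sphere :: "('a, 'b) monoid_scheme \<Rightarrow> ('a \<Rightarrow> nat) \<Rightarrow> nat \<Rightarrow> 'a set" where
  "length_sphere G l n = {x \<in> carrier G. l x = n}"

definition same_length :: "('a, 'b) monoid_scheme \<Rightarrow> ('a \<Rightarrow> nat) \<Rightarrow> ('a \<times> 'a) set" where
  "same_length G l = {(x, y). x \<in> carrier G \<and> y \<in> carrier G \<and> l x = l y}"

lemma equiv_same_length: "equiv (carrier G) (same_length G l)"
  by (auto simp: equiv_def refl_on_def sym_def trans_def same_length_def)

text \<open>Surjectivity makes every sphere nonempty, hence a genuine class; an empty sphere would
  lie in the range on the right but not in the quotient. It also separates spheres of different
  radii, so the quotient is indexed bijectively by \<open>nat\<close>.\<close>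

lemma quotient_same_length:
  assumes "l ` carrier G = UNIV"
  shows "carrier G // same_length G l = range (length_sphere G l)"
proof -
  have cls: "same_length G l `` {x} = length_sphere G l (l x)" if "x \<in> carrier G" for x
    using that by (auto simp: same_length_def length_sphere_def)
  have "carrier G // same_length G l = (\<lambda>x. length_sphere G l (l x)) ` carrier G"
    using cls by (auto simp: quotient_def)
  also have "\<dots> = length_sphere G l ` l ` carrier G"
    by (simp add: image_image)
  finally show ?thesis
    using assms by simp
qed

lemma inj_length_sphere:
  assumes "l ` carrier G = UNIV"
  shows "inj (length_sphere G l)"
proof (rule injI)
  fix m n assume eq: "length_sphere G l m = length_sphere G l n"
  obtain x where "x \<in> carrier G" "l x = m"
    using assms by (metis UNIV_I imageE)
  then show "m = n"
    using eq by (auto simp: length_sphere_def)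
qed

text \<open>By subadditivity, left translation by \<open>g\<close> raises the length by at most
  \<open>l g\<close> and, since \<open>inv g\<close> undoes it, lowers it by at most
  \<open>l (inv g)\<close>. Both the bound on intersected classes and the Folner limit follow from
  this.\<close>

lemma (in group) weakly_amenable_if_length:
  fixes l :: "'a \<Rightarrow> nat"
  assumes cnt: "countable (carrier G)"
    and surj: "l ` carrier G = UNIV"
    and subadd: "\<And>x y. x \<in> carrier G \<Longrightarrow> y \<in> carrier G \<Longrightarrow> l (x \<otimes> y) \<le> l x + l y"
  shows "weakly_amenable G"
proof -
  let ?S = "length_sphere G l" and ?r = "same_length G l"
  note Q = quotient_same_length[OF surj] and inj = inj_length_sphere[OF surj]
  \<comment> \<open>The union of the classes in \<open>A n\<close> is the set of elements of length
    at most \<open>n\<close>; the radii 0 to \<open>n\<close> give \<open>Suc n\<close>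
    classes.\<close>
  define A where "A n = ?S ` {..n}" for n
  have mono: "incseq A"
    by (auto simp: incseq_def A_def)
  have cardA: "card (A n) = Suc n" for n
    using card_image[OF inj_on_subset[OF inj]] by (simp add: A_def)
  have fin: "finite (A n)" for n
    by (simp add: A_def)
  have exhaust: "(\<Union>n. A n) = carrier G // ?r"
    by (auto simp: A_def Q)
  have bounded: "finite {C' \<in> carrier G // ?r. (g <# C) \<inter> C' \<noteq> {}} \<and>
      card {C' \<in> carrier G // ?r. (g <# C) \<inter> C' \<noteq> {}} \<le> Suc (l g + l (inv g))"
    if g: "g \<in> carrier G" and C: "C \<in> carrier G // ?r" for g C
  proof -
    obtain k where k: "C = ?S k"
      using C by (auto simp: Q)
    \<comment> \<open>Truncated subtraction starts the interval at 0 when \<open>k\<close> is less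
      than \<open>l (inv g)\<close>. Either way it has at most \<open>l g + l (inv g) + 1\<close>
      points, a bound independent of \<open>k\<close>.\<close>
    have sub: "{C' \<in> carrier G // ?r. (g <# C) \<inter> C' \<noteq> {}} \<subseteq> ?S ` {k - l (inv g)..k + l g}"
    proof
      fix C' assume C': "C' \<in> {C' \<in> carrier G // ?r. (g <# C) \<inter> C' \<noteq> {}}"
      then obtain m where m: "C' = ?S m"
        by (auto simp: Q)
      obtain x where x: "x \<in> carrier G" "l x = k" "l (g \<otimes> x) = m"
        using C' by (auto simp: m k l_coset_def length_sphere_def)
      have "m \<le> l g + k"
        using subadd[OF g x(1)] x by simp
      moreover have "k \<le> l (inv g) + m"
      proof -
        have "inv g \<otimes> (g \<otimes> x) = x"
          using g x by (simp add: m_assoc[symmetric])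
        then show ?thesis
          using subadd[of "inv g" "g \<otimes> x"] g x by simp
      qed
      ultimately show "C' \<in> ?S ` {k - l (inv g)..k + l g}"
        by (auto simp: m)
    qed
    have "card {C' \<in> carrier G // ?r. (g <# C) \<inter> C' \<noteq> {}} \<le> card {k - l (inv g)..k + l g}"
      using card_mono[OF _ sub] card_image_le[of "{k - l (inv g)..k + l g}" ?S] by simp
    also have "\<dots> \<le> Suc (l g + l (inv g))"
      by simp
    finally show ?thesis
      using finite_subset[OF sub] by simp
  qed
  have folner: "(\<lambda>n. real (card {C \<in> A n. g <# C \<subseteq> \<Union>(A n)}) / real (card (A n))) \<longlonglongrightarrow> 1"
    if g: "g \<in> carrier G" for g
  proof (rule tendsto_sandwich)
    \<comment> \<open>A sphere of radius \<open>k\<close> with \<open>k + l g \<le> n\<close> is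
      moved into the elements of length at most \<open>n\<close>, so at most the outermost
      \<open>l g\<close> spheres fail. For \<open>n < l g\<close> the truncated difference is 0 or
      harmless and the inequality still holds.\<close>
    have ge: "Suc n - l g \<le> card {C \<in> A n. g <# C \<subseteq> \<Union>(A n)}" for n
    proof -
      have "?S ` {..<Suc n - l g} \<subseteq> {C \<in> A n. g <# C \<subseteq> \<Union>(A n)}"
      proof clarify
        fix k assume k: "k < Suc n - l g"
        have "l (g \<otimes> x) \<le> n" if "x \<in> carrier G" "l x = k" for x
          using subadd[OF g that(1)] that(2) k by simp
        then have "g <# ?S k \<subseteq> \<Union>(A n)"
          using g by (auto simp: l_coset_def A_def length_sphere_def)
        then show "?S k \<in> A n \<and> g <# ?S k \<subseteq> \<Union>(A n)"
          using k by (auto simp: A_def)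
      qed
      then have "card (?S ` {..<Suc n - l g}) \<le> card {C \<in> A n. g <# C \<subseteq> \<Union>(A n)}"
        by (rule card_mono[rotated]) (simp add: fin)
      then show ?thesis
        using card_image[OF inj_on_subset[OF inj, of "{..<Suc n - l g}"]] by simp
    qed
    show "\<forall>\<^sub>F n in sequentially. 1 - real (l g) * inverse (real (Suc n))
        \<le> real (card {C \<in> A n. g <# C \<subseteq> \<Union>(A n)}) / real (card (A n))"
    proof (rule always_eventually, rule allI)
      fix n
      have "real (Suc n) - real (l g) \<le> real (card {C \<in> A n. g <# C \<subseteq> \<Union>(A n)})"
        using ge[of n] by linarith
      then have "(real (Suc n) - real (l g)) / real (Suc n)
          \<le> real (card {C \<in> A n. g <# C \<subseteq> \<Union>(A n)}) / real (card (A n))"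
        unfolding cardA by (rule divide_right_mono) simp
      moreover have "(real (Suc n) - real (l g)) / real (Suc n)
          = 1 - real (l g) * inverse (real (Suc n))"
        by (simp add: divide_inverse left_diff_distrib del: of_nat_Suc)
      ultimately show "1 - real (l g) * inverse (real (Suc n))
          \<le> real (card {C \<in> A n. g <# C \<subseteq> \<Union>(A n)}) / real (card (A n))"
        by simp
    qed
    show "\<forall>\<^sub>F n in sequentially.
        real (card {C \<in> A n. g <# C \<subseteq> \<Union>(A n)}) / real (card (A n)) \<le> 1"
    proof (rule always_eventually, rule allI)
      fix n
      have "card {C \<in> A n. g <# C \<subseteq> \<Union>(A n)} \<le> card (A n)"
        by (rule card_mono) (auto simp: fin)
      then show "real (card {C \<in> A n. g <# C \<subseteq> \<Union>(A n)}) / real (card (A n)) \<le> 1"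
        by (simp add: cardA)
    qed
    show "(\<lambda>n. 1 - real (l g) * inverse (real (Suc n))) \<longlonglongrightarrow> 1"
      using tendsto_diff[OF tendsto_const tendsto_mult_right_zero[OF LIMSEQ_inverse_real_of_nat]]
      by fastforce
  qed (rule tendsto_const)
  have inf: "infinite (carrier G // ?r)"
    using inj by (simp add: Q range_inj_infinite)
  have "\<forall>g\<in>carrier G. \<exists>b::nat. \<forall>C\<in>carrier G // ?r.
      finite {C' \<in> carrier G // ?r. (g <# C) \<inter> C' \<noteq> {}} \<and>
      card {C' \<in> carrier G // ?r. (g <# C) \<inter> C' \<noteq> {}} \<le> b"
    by (intro ballI exI) (rule bounded)
  moreover have "\<exists>A. incseq A \<and> (\<forall>n. finite (A n)) \<and> (\<Union>n. A n) = carrier G // ?r \<and>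
      (\<forall>g\<in>carrier G.
        (\<lambda>n. real (card {C \<in> A n. g <# C \<subseteq> \<Union>(A n)}) / real (card (A n))) \<longlonglongrightarrow> 1)"
    by (rule exI[of _ A], intro conjI allI ballI mono fin exhaust folner)
  ultimately show ?thesis
    unfolding weakly_amenable_def
    by (intro conjI is_group cnt disjI2 exI[of _ ?r] equiv_same_length inf)
qed

section \<open>Word balls and word length\<close>

primrec word_ball :: "('a, 'b) monoid_scheme \<Rightarrow> 'a set \<Rightarrow> nat \<Rightarrow> 'a set" where
  "word_ball G T 0 = {\<one>\<^bsub>G\<^esub>}"
| "word_ball G T (Suc n) = word_ball G T n \<union> (T <#>\<^bsub>G\<^esub> word_ball G T n)"

text \<open>\<open>LEAST\<close> is meaningful only for elements lying in some ball, which explains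
  the membership hypotheses in the lemmas below.\<close>

definition word_length :: "('a, 'b) monoid_scheme \<Rightarrow> 'a set \<Rightarrow> 'a \<Rightarrow> nat" where
  "word_length G T x = (LEAST n. x \<in> word_ball G T n)"

context group
begin

lemma word_ball_carrier: "T \<subseteq> carrier G \<Longrightarrow> word_ball G T n \<subseteq> carrier G"
  by (induction n) (auto simp: set_mult_def)

lemma finite_word_ball: "finite T \<Longrightarrow> finite (word_ball G T n)"
  by (induction n) (auto simp: set_mult_def)

lemma word_ball_mono: "m \<le> n \<Longrightarrow> word_ball G T m \<subseteq> word_ball G T n"
  by (rule lift_Suc_mono_le) auto

text \<open>Concatenation of words: balls grow by a generator on the left, so the induction runs
  over the left factor and reassociates its first letter.\<close>

lemma word_ball_mult:
  assumes T: "T \<subseteq> carrier G" and x: "x \<in> word_ball G T m" and y: "y \<in> word_ball G T n"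
  shows "x \<otimes> y \<in> word_ball G T (m + n)"
  using x
proof (induction m arbitrary: x)
  case 0
  then show ?case
    using y word_ball_carrier[OF T, of n] by auto
next
  case (Suc m)
  have yc: "y \<in> carrier G"
    using y word_ball_carrier[OF T] by blast
  consider "x \<in> word_ball G T m" | s z where "s \<in> T" "z \<in> word_ball G T m" "x = s \<otimes> z"
    using Suc.prems by (auto simp: set_mult_def)
  then show ?case
  proof cases
    case 1
    then show ?thesis
      using Suc.IH by simp
  next
    case 2
    have "x \<otimes> y = s \<otimes> (z \<otimes> y)"
      using 2 yc T word_ball_carrier[OF T, of m] by (simp add: m_assoc subset_iff)
    then show ?thesis
      using 2 Suc.IH[of z] by (auto simp: set_mult_def)
  qed
qed

lemma generate_subset_Union_word_ball:
  assumes S: "S \<subseteq> carrier G"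
  shows "generate G S \<subseteq> (\<Union>n. word_ball G (S \<union> m_inv G ` S) n)"
proof
  let ?T = "S \<union> m_inv G ` S"
  have T: "?T \<subseteq> carrier G"
    using S by auto
  have gen: "s \<in> word_ball G ?T 1" if "s \<in> ?T" for s
    using that T by (force simp: set_mult_def)
  fix x assume "x \<in> generate G S"
  then show "x \<in> (\<Union>n. word_ball G ?T n)"
  proof (induction rule: generate.induct)
    case one
    have "\<one> \<in> word_ball G ?T 0"
      by simp
    then show ?case
      by blast
  next
    case (incl h)
    then show ?case
      using gen by blast
  next
    case (inv h)
    then show ?case
      using gen by blast
  next
    case (eng h1 h2)
    then show ?case
      using word_ball_mult[OF T] by blast
  qed
qed

lemma word_length_le: "x \<in> word_ball G T n \<Longrightarrow> word_length G T x \<le> n"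
  unfolding word_length_def by (rule Least_le)

lemma word_ball_word_length:
  "x \<in> (\<Union>n. word_ball G T n) \<Longrightarrow> x \<in> word_ball G T (word_length G T x)"
  unfolding word_length_def by (auto intro: LeastI)

lemma word_length_mult_le:
  assumes "T \<subseteq> carrier G" "x \<in> (\<Union>n. word_ball G T n)" "y \<in> (\<Union>n. word_ball G T n)"
  shows "word_length G T (x \<otimes> y) \<le> word_length G T x + word_length G T y"
  using assms by (intro word_length_le word_ball_mult word_ball_word_length)

text \<open>Each ball is determined by the preceding one, so a single repetition persists.\<close>

lemma word_ball_stationary:
  assumes "word_ball G T (Suc n) = word_ball G T n"
  shows "word_ball G T (n + k) = word_ball G T n"
  using assms by (induction k) auto

text \<open>A skipped length would mean two equal consecutive balls, so all balls would lie in one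
  finite ball, contradicting infinitude. An element new in the ball of radius \<open>Suc m\<close>
  has length exactly \<open>Suc m\<close>.\<close>

lemma word_length_surj:
  assumes fin: "finite T" and inf: "infinite (\<Union>n. word_ball G T n)"
  shows "word_length G T ` (\<Union>n. word_ball G T n) = UNIV"
proof -
  have "\<exists>x \<in> (\<Union>n. word_ball G T n). word_length G T x = n" for n
  proof (cases n)
    case 0
    have "\<one> \<in> word_ball G T 0"
      by simp
    then show ?thesis
      using word_length_le 0 by blast
  next
    case (Suc m)
    have "word_ball G T (Suc m) \<noteq> word_ball G T m"
    proof
      assume eq: "word_ball G T (Suc m) = word_ball G T m"
      have "word_ball G T k \<subseteq> word_ball G T m" for k
        using word_ball_mono[of k "m + k" T] word_ball_stationary[OF eq, of k] by simp
      then have "(\<Union>n. word_ball G T n) \<subseteq> word_ball G T m"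
        by blast
      then show False
        using inf finite_subset finite_word_ball[OF fin] by blast
    qed
    then obtain x where x: "x \<in> word_ball G T (Suc m)" "x \<notin> word_ball G T m"
      by auto
    then have xU: "x \<in> (\<Union>n. word_ball G T n)"
      by blast
    have "\<not> word_length G T x \<le> m"
      using word_ball_word_length[OF xU] word_ball_mono x(2) by blast
    then have "word_length G T x = n"
      using word_length_le[OF x(1)] Suc by simp
    then show ?thesis
      using xU by blast
  qed
  then show ?thesis
    by (metis UNIV_eq_I imageI)
qed

end

theorem theorem3p3:
  fixes G :: "('a, 'b) monoid_scheme"
  assumes "finitely_generated_group G"
  shows "weakly_amenable G"
proof -
  interpret group G
    using assms by (simp add: finitely_generated_group_def)
  obtain S where S: "finite S" "S \<subseteq> carrier G" "generate G S = carrier G"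
    using assms by (auto simp: finitely_generated_group_def)
  define T where "T = S \<union> m_inv G ` S"
  have T: "T \<subseteq> carrier G" "finite T"
    using S by (auto simp: T_def)
  have U: "(\<Union>n. word_ball G T n) = carrier G"
    using generate_subset_Union_word_ball[OF S(2)] word_ball_carrier[OF T(1)] S(3)
    unfolding T_def by blast
  \<comment> \<open>The group is a countable union of finite balls.\<close>
  have cnt: "countable (carrier G)"
    unfolding U[symmetric] by (intro countable_UN) (auto intro: countable_finite finite_word_ball T)
  show ?thesis
  \<comment> \<open>Word length on a finite group is bounded, hence not surjective; that case is
    settled by the first alternative of the definition.\<close>
  proof (cases "finite (carrier G)")
    case True
    then show ?thesis
      using cnt is_group by (simp add: weakly_amenable_def)
  next
    case False
    show ?thesis
    proof (rule weakly_amenable_if_length[OF cnt])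
      show "word_length G T ` carrier G = UNIV"
        using word_length_surj[OF T(2)] False unfolding U by blast
      show "word_length G T (x \<otimes>\<^bsub>G\<^esub> y) \<le> word_length G T x + word_length G T y"
        if "x \<in> carrier G" "y \<in> carrier G" for x y
        using word_length_mult_le[OF T(1)] that unfolding U by blast
    qed
  qed
qed

end
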